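(* Let $Q=(\triangle_{D_{n+1}},\xi)$ be a Dynkin quiver of type $D_{n+1}$ with $\xi_n=\xi_{n+1}$ (i.e. $\vee$-fixed), let $\overline Q=(\triangle_{B_n},\overline\xi)$ be the Dynkin quiver of type $B_n$ with $\overline\xi_i=\xi_i$ for $1\le i\le n$, and let $k\in\mathbb Z$. Then $$\psi\bigl(\tau_Q^k(\gamma_i^Q)\bigr)=\tau_{\overline Q}^k(\gamma_i^{\overline Q})\quad\text{for } 1\le i<n,$$ and $$\psi\bigl(\tau_Q^k(\gamma_i^Q)\bigr)=\tau_{\overline Q}^k(\gamma_n^{\overline Q})\quad\text{for } i=n\text{ or }n+1.$$
   Context: For a finite Dynkin diagram $\triangle$ with vertex set $I$ and fundamental weights $\varpi_i$, a Dynkin quiver $Q=(\triangle,\xi)$ is given by a height function $\xi:I\to\mathbb Z$ with $|\xi_i-\xi_j|=1$ for adjacent $i,j$. $i$ is a source if $\xi_i>\xi_j$ for all neighbours $j$; then $s_iQ=(\triangle,s_i\xi)$, $(s_i\xi)_j=\xi_j-2\delta_{i,j}$. A reduced expression $s_{i_1}\cdots s_{i_l}$ in the Weyl group is $Q$-adapted if $i_k$ is a source of $s_{i_{k-1}}\cdots s_{i_1}Q$ for all $k$. $\tau_Q$ is the unique Coxeter element all of whose reduced expressions are $Q$-adapted; $\gamma_i^Q=(1-\tau_Q)\varpi_i\in\Phi^+$. Type $D_{n+1}$: nodes $1,\dots,n+1$, $1-\cdots-(n-1)$ a chain, $n$ and $n+1$ both attached to $n-1$; $\alpha_i=\epsilon_i-\epsilon_{i+1}$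 ($i\le n$), $\alpha_{n+1}=\epsilon_n+\epsilon_{n+1}$. $\vee$ exchanges $n$ and $n+1$. Type $B_n$: nodes $1,\dots,n$ in a chain, $\alpha_n$ the short simple root; $\alpha_i=\varepsilon_i-\varepsilon_{i+1}$ ($i<n$), $\alpha_n=\varepsilon_n$. $\psi$ is the linear map from the root lattice of $D_{n+1}$ to that of $B_n$ with $\psi(\alpha_i)=\alpha_i$ for $i\le n$ and $\psi(\alpha_{n+1})=\alpha_n$ (equivalently $\psi(\epsilon_i)=\varepsilon_i$ for $i\le n$, $\psi(\epsilon_{n+1})=0$); it restricts to a surjection $\Phi^+_{D_{n+1}}\to\Phi^+_{B_n}$. *)

theory Defs
  imports Complex_Main
begin

text \<open>
  Vectors of the Euclidean space with orthonormal basis \<open>\<epsilon> 1, \<dots>, \<epsilon> m\<close> are functions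
  \<open>nat \<Rightarrow> real\<close> that vanish outside \<open>{1..m}\<close>. Reflections are defined on all functions
  \<open>nat \<Rightarrow> real\<close> and leave the coordinates outside \<open>{1..m}\<close> unchanged, so two Weyl group
  elements agree as functions iff they agree on the Euclidean space.
\<close>

type_synonym vec = "nat \<Rightarrow> real"

definition eps :: "nat \<Rightarrow> vec" where
  "eps i = (\<lambda>j. if j = i then 1 else 0)"

text \<open>\<open>TypeB m\<close> is meant for \<open>m \<ge> 2\<close> and \<open>TypeD m\<close> for \<open>m \<ge> 3\<close>.\<close>

datatype dynkin = TypeB nat | TypeD nat

fun rank :: "dynkin \<Rightarrow> nat" where
  "rank (TypeB m) = m"
| "rank (TypeD m) = m"

definition nodes :: "dynkin \<Rightarrow> nat set" where
  "nodes X = {1..rank X}"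

fun edges :: "dynkin \<Rightarrow> nat set set" where
  "edges (TypeB m) = {{i, i + 1} | i. 1 \<le> i \<and> i + 1 \<le> m}"
| "edges (TypeD m) = {{i, i + 1} | i. 1 \<le> i \<and> i + 1 < m} \<union> {{m - 2, m}}"

definition adjacent :: "dynkin \<Rightarrow> nat \<Rightarrow> nat \<Rightarrow> bool" where
  "adjacent X i j \<longleftrightarrow> {i, j} \<in> edges X"

fun simple_root :: "dynkin \<Rightarrow> nat \<Rightarrow> vec" where
  "simple_root (TypeB m) i = (if i < m then (\<lambda>j. eps i j - eps (i + 1) j) else eps m)"
| "simple_root (TypeD m) i =
     (if i < m then (\<lambda>j. eps i j - eps (i + 1) j) else (\<lambda>j. eps (m - 1) j + eps m j))"

definition ip :: "dynkin \<Rightarrow> vec \<Rightarrow> vec \<Rightarrow> real" where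
  "ip X u v = (\<Sum>j\<in>{1..rank X}. u j * v j)"

definition coroot_pairing :: "dynkin \<Rightarrow> nat \<Rightarrow> vec \<Rightarrow> real" where
  "coroot_pairing X i v =
     2 * ip X v (simple_root X i) / ip X (simple_root X i) (simple_root X i)"

definition simple_refl :: "dynkin \<Rightarrow> nat \<Rightarrow> vec \<Rightarrow> vec" where
  "simple_refl X i v = (\<lambda>j. v j - coroot_pairing X i v * simple_root X i j)"

definition fund_weight :: "dynkin \<Rightarrow> nat \<Rightarrow> vec" where
  "fund_weight X i =
     (THE v. (\<forall>j. j \<notin> {1..rank X} \<longrightarrow> v j = 0) \<and>
             (\<forall>j\<in>nodes X. coroot_pairing X j v = (if j = i then 1 else 0)))"

definition word_prod :: "dynkin \<Rightarrow> nat list \<Rightarrow> vec \<Rightarrow> vec" where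
  "word_prod X ws = foldr (\<lambda>i f. simple_refl X i \<circ> f) ws id"

definition reduced_expression :: "dynkin \<Rightarrow> (vec \<Rightarrow> vec) \<Rightarrow> nat list \<Rightarrow> bool" where
  "reduced_expression X w ws \<longleftrightarrow>
     set ws \<subseteq> nodes X \<and> word_prod X ws = w \<and>
     (\<forall>vs. set vs \<subseteq> nodes X \<and> word_prod X vs = w \<longrightarrow> length ws \<le> length vs)"

definition coxeter_element :: "dynkin \<Rightarrow> (vec \<Rightarrow> vec) \<Rightarrow> bool" where
  "coxeter_element X w \<longleftrightarrow> (\<exists>ws. distinct ws \<and> set ws = nodes X \<and> word_prod X ws = w)"

text \<open>Only the values of a height function on the nodes of the diagram are meaningful.\<close>

record quiver =
  diagram :: dynkin
  height :: "nat \<Rightarrow> int"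

definition dynkin_quiver :: "quiver \<Rightarrow> bool" where
  "dynkin_quiver Q \<longleftrightarrow>
     (\<forall>i\<in>nodes (diagram Q). \<forall>j\<in>nodes (diagram Q).
        adjacent (diagram Q) i j \<longrightarrow> \<bar>height Q i - height Q j\<bar> = 1)"

definition source :: "quiver \<Rightarrow> nat \<Rightarrow> bool" where
  "source Q i \<longleftrightarrow> i \<in> nodes (diagram Q) \<and>
     (\<forall>j\<in>nodes (diagram Q). adjacent (diagram Q) i j \<longrightarrow> height Q i > height Q j)"

definition reflect_quiver :: "nat \<Rightarrow> quiver \<Rightarrow> quiver" where
  "reflect_quiver i Q =
     Q\<lparr>height := (\<lambda>j. height Q j - 2 * (if i = j then 1 else 0))\<rparr>"

definition adapted :: "quiver \<Rightarrow> nat list \<Rightarrow> bool" where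
  "adapted Q ws \<longleftrightarrow> (\<forall>k<length ws. source (fold reflect_quiver (take k ws) Q) (ws ! k))"

definition tau :: "quiver \<Rightarrow> vec \<Rightarrow> vec" where
  "tau Q = (THE w. coxeter_element (diagram Q) w \<and>
                   (\<forall>ws. reduced_expression (diagram Q) w ws \<longrightarrow> adapted Q ws))"

definition gamma :: "quiver \<Rightarrow> nat \<Rightarrow> vec" where
  "gamma Q i = (\<lambda>j. fund_weight (diagram Q) i j - tau Q (fund_weight (diagram Q) i) j)"

definition int_power :: "(vec \<Rightarrow> vec) \<Rightarrow> int \<Rightarrow> vec \<Rightarrow> vec" where
  "int_power f k = (if k \<ge> 0 then f ^^ nat k else inv f ^^ nat (- k))"

text \<open>
  The linear map \<open>\<psi>\<close> from type \<open>D\<close> of rank \<open>n + 1\<close> to type \<open>B\<close> of rank \<open>n\<close>, extended from the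
  root lattice to the ambient space: \<open>\<epsilon> i \<mapsto> \<epsilon> i\<close> for \<open>i \<le> n\<close> and \<open>\<epsilon> (n + 1) \<mapsto> 0\<close>. The lemmas
  below give the description on simple roots.
\<close>

definition psi :: "nat \<Rightarrow> vec \<Rightarrow> vec" where
  "psi n v = (\<lambda>j. if j \<in> {1..n} then v j else 0)"

lemma psi_linear:
  "psi n (\<lambda>j. a * u j + b * v j) = (\<lambda>j. a * psi n u j + b * psi n v j)"
  by (auto simp: psi_def)

lemma psi_simple_root:
  assumes "1 \<le> i" "i \<le> n"
  shows "psi n (simple_root (TypeD (n + 1)) i) = simple_root (TypeB n) i"
  using assms by (auto simp: psi_def eps_def fun_eq_iff)

lemma psi_simple_root_last:
  assumes "1 \<le> n"
  shows "psi n (simple_root (TypeD (n + 1)) (n + 1)) = simple_root (TypeB n) n"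
  using assms by (auto simp: psi_def eps_def fun_eq_iff)

text \<open>
  Simple reflections are bijective on all of \<open>vec\<close>, so \<open>inv\<close> in \<^const>\<open>int_power\<close> is the
  inverse in the Weyl group.
\<close>

lemma coroot_pairing_simple_root:
  assumes "i \<in> nodes X" "X = TypeD m \<Longrightarrow> 2 \<le> m"
  shows "coroot_pairing X i (simple_root X i) = 2"
proof -
  obtain j where j: "j \<in> {1..rank X}" "simple_root X i j \<noteq> 0"
  proof (cases X)
    case (TypeB m)
    then show ?thesis using assms that[of i]
      by (auto simp: nodes_def eps_def split: if_splits)
  next
    case (TypeD m)
    then show ?thesis using assms that[of i]
      by (auto simp: nodes_def eps_def split: if_splits)
  qed
  have "ip X (simple_root X i) (simple_root X i) > 0"
    unfolding ip_def using j by (intro sum_pos2[of _ j]) (auto simp: zero_less_mult_iff)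
  then show ?thesis by (simp add: coroot_pairing_def)
qed

lemma simple_refl_involution:
  assumes "i \<in> nodes X" "X = TypeD m \<Longrightarrow> 2 \<le> m"
  shows "simple_refl X i (simple_refl X i v) = v"
proof -
  let ?a = "simple_root X i"
  have "coroot_pairing X i (\<lambda>j. v j - c * ?a j) = coroot_pairing X i v - c * coroot_pairing X i ?a"
    for c
    by (simp add: coroot_pairing_def ip_def left_diff_distrib sum_subtractf
        sum_distrib_left mult_ac diff_divide_distrib right_diff_distrib)
  then show ?thesis
    using coroot_pairing_simple_root[OF assms]
    by (auto simp: simple_refl_def fun_eq_iff)
qed

end

theory Submission
  imports Defs
begin

text \<open>
  The ordering of the letters of an adapted word for a Coxeter element is constrained only along
  edges, so any two adapted words differ by commutations. Conversely, the element determines the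
  order of adjacent letters: if \<open>i\<close> is preceded by the letters \<open>us\<close>, then
  \<open>(1 - w) \<varpi>\<^sub>i = us(\<alpha>\<^sub>i)\<close>, and for \<open>j\<close> adjacent to \<open>i\<close> the coefficient of \<open>\<alpha>\<^sub>j\<close> in it is
  positive if \<open>j\<close> occurs in \<open>us\<close> and zero otherwise. Hence \<open>\<tau>\<close> is the product of the nodes in
  order of decreasing height. Replacing the letter \<open>n\<close> of such a word in type \<open>B\<^sub>n\<close> by
  \<open>n, n + 1\<close> gives such a word in type \<open>D\<close>, and \<open>\<psi>\<close> intertwines the two products.
\<close>

section \<open>Simple roots in coordinates and the signs of the Cartan matrix\<close>

text \<open>The bound 3 makes \<open>m - 2\<close> a node of \<open>TypeD m\<close>; it admits D_3 =
  A_3, which is paired with B_2.\<close>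

definition admissible :: "dynkin \<Rightarrow> bool" where
  "admissible X \<longleftrightarrow> (\<exists>m. X = TypeB m \<and> 2 \<le> m \<or> X = TypeD m \<and> 3 \<le> m)"

lemma admissible_cases [consumes 1, case_names B D]:
  assumes "admissible X"
  obtains m where "X = TypeB m" "2 \<le> m" | m where "X = TypeD m" "3 \<le> m"
  using assms unfolding admissible_def by blast

lemma finite_nodes [simp]: "finite (nodes X)"
  by (simp add: nodes_def)

lemma ip_add_right: "ip X u (\<lambda>j. v j + w j) = ip X u v + ip X u w"
  by (simp add: ip_def sum.distrib algebra_simps)

lemma ip_diff_right: "ip X u (\<lambda>j. v j - w j) = ip X u v - ip X u w"
  by (simp add: ip_def sum_subtractf algebra_simps)

lemma eps_apply: "eps i j = (if j = i then 1 else 0)"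
  by (simp add: eps_def)

lemma ip_eps_right: "ip X v (eps i) = (if i \<in> nodes X then v i else 0)"
proof -
  have "v j * eps i j = (if j = i then v i else 0)" for j
    by (simp add: eps_def)
  then show ?thesis
    by (simp add: ip_def nodes_def)
qed

lemmas ip_simps = ip_add_right ip_diff_right ip_eps_right

text \<open>The factor 2 at the last node comes from the short root \<open>eps m\<close>, of squared
  norm 1.\<close>

lemma coroot_pairing_B:
  assumes "1 \<le> i" "i \<le> m"
  shows "coroot_pairing (TypeB m) i v = (if i < m then v i - v (i + 1) else 2 * v m)"
  using assms
  by (cases "i < m") (simp_all add: coroot_pairing_def ip_simps nodes_def, auto simp: eps_apply)

lemma coroot_pairing_D:
  assumes "1 \<le> i" "i \<le> m" "3 \<le> m"
  shows "coroot_pairing (TypeD m) i v = (if i < m then v i - v (i + 1) else v (m - 1) + v m)"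
proof -
  \<comment> \<open>So \<open>m - 1\<close> is a node different from \<open>m\<close>, and the two
    summands of the last simple root are orthogonal.\<close>
  have "Suc 0 \<le> m - Suc 0" "m - Suc 0 \<noteq> m" using assms by auto
  then show ?thesis
    using assms
  by (cases "i < m") (simp_all add: coroot_pairing_def ip_simps nodes_def, auto simp: eps_apply)
qed

lemma ip_simple_root_self_pos:
  assumes "admissible X" "i \<in> nodes X"
  shows "ip X (simple_root X i) (simple_root X i) > 0"
proof -
  have "ip X (simple_root X i) (simple_root X i) \<ge> 0"
    unfolding ip_def by (intro sum_nonneg) simp
  moreover have "coroot_pairing X i (simple_root X i) = 2"
    using assms by (intro coroot_pairing_simple_root) (auto simp: admissible_def)
  ultimately show ?thesis
    by (cases "ip X (simple_root X i) (simple_root X i) = 0") (simp_all add: coroot_pairing_def)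
qed

lemma adjacent_irrefl: "admissible X \<Longrightarrow> \<not> adjacent X i i"
  by (cases rule: admissible_cases) (auto simp: adjacent_def doubleton_eq_iff)

lemma adjacent_sym: "adjacent X i j \<Longrightarrow> adjacent X j i"
  by (simp add: adjacent_def insert_commute)

lemma adjacent_B:
  "adjacent (TypeB m) i j \<longleftrightarrow> 1 \<le> i \<and> 1 \<le> j \<and> i \<le> m \<and> j \<le> m \<and> (j = i + 1 \<or> i = j + 1)"
  by (auto simp: adjacent_def doubleton_eq_iff)

lemma adjacent_D:
  "adjacent (TypeD m) i j \<longleftrightarrow> 1 \<le> i \<and> 1 \<le> j \<and> i < m \<and> j < m \<and> (j = i + 1 \<or> i = j + 1) \<or>
     i = m - 2 \<and> j = m \<or> j = m - 2 \<and> i = m"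
  by (auto simp: adjacent_def doubleton_eq_iff)

text \<open>Keeping only the signs of the Cartan matrix allows both types to be treated uniformly
  from here on.\<close>

lemma coroot_pairing_simple_root_sign:
  assumes "admissible X" "i \<in> nodes X" "j \<in> nodes X" "i \<noteq> j"
  shows "if adjacent X i j then coroot_pairing X i (simple_root X j) < 0
         else coroot_pairing X i (simple_root X j) = 0"
  using assms(1)
proof (cases rule: admissible_cases)
  case (B m)
  then show ?thesis using assms
    by (auto simp: adjacent_B nodes_def coroot_pairing_B eps_apply)
next
  case (D m)
  then show ?thesis using assms
    by (auto simp: adjacent_D nodes_def coroot_pairing_D eps_apply)
qed

lemma coroot_pairing_linear:
  "coroot_pairing X i (\<lambda>j. u j + c * v j) = coroot_pairing X i u + c * coroot_pairing X i v"
  by (simp add: coroot_pairing_def ip_def algebra_simps sum.distrib sum_distrib_left add_divide_distrib)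

lemma coroot_pairing_diff:
  "coroot_pairing X i (\<lambda>j. u j - v j) = coroot_pairing X i u - coroot_pairing X i v"
  using coroot_pairing_linear[of X i u "-1" v] by simp

lemma coroot_pairing_sum:
  "coroot_pairing X i (\<lambda>j. \<Sum>k\<in>A. c k * f k j) = (\<Sum>k\<in>A. c k * coroot_pairing X i (f k))"
proof (induction A rule: infinite_finite_induct)
  case (insert x A)
  then show ?case
    using coroot_pairing_linear[of X i "\<lambda>j. \<Sum>k\<in>A. c k * f k j" "c x" "f x"]
    by (simp add: add.commute)
qed (simp_all add: coroot_pairing_def ip_def)

lemma simple_refl_commute:
  assumes "admissible X" "i \<in> nodes X" "j \<in> nodes X" "i \<noteq> j" "\<not> adjacent X i j"
  shows "simple_refl X i \<circ> simple_refl X j = simple_refl X j \<circ> simple_refl X i"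
proof -
  have "coroot_pairing X i (simple_root X j) = 0" "coroot_pairing X j (simple_root X i) = 0"
    using coroot_pairing_simple_root_sign[of X i j] coroot_pairing_simple_root_sign[of X j i]
      assms adjacent_sym[of X j i] by (auto split: if_splits)
  then show ?thesis
    using coroot_pairing_linear[of X i _ "- _" "simple_root X j"]
      coroot_pairing_linear[of X j _ "- _" "simple_root X i"]
    by (auto simp: simple_refl_def fun_eq_iff)
qed

section \<open>Fundamental weights and coefficients with respect to the simple roots\<close>

text \<open>Discharges the definite description: the difference of two solutions is orthogonal to
  all simple roots and hence zero.\<close>

lemma fund_weightI:
  assumes X: "admissible X"
    and v: "\<forall>j. j \<notin> nodes X \<longrightarrow> v j = 0"
      "\<forall>j\<in>nodes X. coroot_pairing X j v = (if j = i then 1 else 0)"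
  shows "fund_weight X i = v"
  unfolding fund_weight_def
proof (rule the_equality)
  fix u :: vec
  assume u: "(\<forall>j. j \<notin> {1..rank X} \<longrightarrow> u j = 0) \<and>
             (\<forall>j\<in>nodes X. coroot_pairing X j u = (if j = i then 1 else 0))"
  define d where "d = (\<lambda>j. u j - v j)"
  have pairing: "coroot_pairing X j d = 0" if "j \<in> nodes X" for j
    using u v(2) that by (simp add: d_def coroot_pairing_diff)
  have outside: "d j = 0" if "j \<notin> nodes X" for j
    using u v(1) that by (simp add: d_def nodes_def)
  \<comment> \<open>The roots \<open>\<alpha>\<^sub>j\<close> with \<open>j < m\<close> make
    \<open>d\<close> constant along the chain, so the vanishing of its last coordinate spreads to
    all.\<close>
  have descend: "d j = 0"
    if "\<And>j. 1 \<le> j \<Longrightarrow> j < m \<Longrightarrow> d j = d (j + 1)" "d m = 0" "1 \<le> j" "j \<le> m" for j m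
    using that(4,3,1,2) by (induction rule: inc_induct) simp_all
  have "d j = 0" if "j \<in> nodes X" for j
    using X
  proof (cases rule: admissible_cases)
    case (B m)
    have "d j = d (j + 1)" if "1 \<le> j" "j < m" for j
      using pairing[of j] that B by (simp add: coroot_pairing_B nodes_def)
    moreover have "d m = 0"
      using pairing[of m] B by (simp add: coroot_pairing_B nodes_def)
    moreover have "1 \<le> j" "j \<le> m" using that B by (auto simp: nodes_def)
    ultimately show ?thesis using descend by blast
  next
    case (D m)
    have 1: "d j = d (j + 1)" if "1 \<le> j" "j < m" for j
      using pairing[of j] that D by (simp add: coroot_pairing_D nodes_def)
    \<comment> \<open>The two end nodes of the fork say that the last two coordinates are both
      opposite and equal.\<close>
    have "d (m - 1) + d m = 0"
      using pairing[of m] D by (simp add: coroot_pairing_D nodes_def)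
    moreover have "d (m - 1) = d m"
      using 1[of "m - 1"] D by auto
    ultimately have "d m = 0" by simp
    moreover have "1 \<le> j" "j \<le> m" using that D by (auto simp: nodes_def)
    ultimately show ?thesis using descend 1 by blast
  qed
  with outside show "u = v" by (fastforce simp: d_def fun_eq_iff)
qed (use v in \<open>auto simp: nodes_def\<close>)

lemma fund_weight_B:
  assumes "2 \<le> m" "1 \<le> i" "i \<le> m"
  shows "fund_weight (TypeB m) i =
    (\<lambda>j. if 1 \<le> j \<and> j \<le> i then if i < m then 1 else 1 / 2 else 0)"
  using assms by (intro fund_weightI) (auto simp: admissible_def nodes_def coroot_pairing_B)

text \<open>The last two nodes give the half-spin weights, which differ only in the sign of the last
  coordinate.\<close>

lemma fund_weight_D:
  assumes "3 \<le> m" "1 \<le> i" "i \<le> m"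
  shows "fund_weight (TypeD m) i =
    (if i < m - 1 then (\<lambda>j. if 1 \<le> j \<and> j \<le> i then 1 else 0)
     else (\<lambda>j. if 1 \<le> j \<and> j < m then 1 / 2
               else if j = m then if i = m then 1 / 2 else - 1 / 2 else 0))"
  using assms by (intro fund_weightI) (auto simp: admissible_def nodes_def coroot_pairing_D)

lemma coroot_pairing_fund_weight:
  assumes "admissible X" "i \<in> nodes X" "j \<in> nodes X"
  shows "coroot_pairing X j (fund_weight X i) = (if j = i then 1 else 0)"
  using assms(1)
proof (cases rule: admissible_cases)
  case (B m)
  then show ?thesis using assms
    by (auto simp: nodes_def fund_weight_B coroot_pairing_B)
next
  case (D m)
  then show ?thesis using assms
    by (auto simp: nodes_def fund_weight_D coroot_pairing_D)
qed

lemma ip_fund_weight_simple_root: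
  assumes "admissible X" "i \<in> nodes X" "j \<in> nodes X"
  shows "ip X (fund_weight X i) (simple_root X j) =
    (if j = i then ip X (simple_root X i) (simple_root X i) / 2 else 0)"
  using coroot_pairing_fund_weight[OF assms] ip_simple_root_self_pos[OF assms(1,3)]
  by (auto simp: coroot_pairing_def field_simps split: if_splits)

text \<open>Pairing with \<open>fund_weight X i\<close> kills every simple root except the one at
  \<open>i\<close>, where the value is positive, and so reads off that coefficient.\<close>

lemma simple_root_coeffs_unique:
  assumes "admissible X" "i \<in> nodes X"
    and "(\<lambda>j. \<Sum>k\<in>nodes X. c k * simple_root X k j) = (\<lambda>j. \<Sum>k\<in>nodes X. d k * simple_root X k j)"
  shows "c i = d i"
proof -
  have "ip X (fund_weight X i) (\<lambda>j. \<Sum>k\<in>nodes X. b k * simple_root X k j) =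
        b i * (ip X (simple_root X i) (simple_root X i) / 2)" for b
  proof -
    have "ip X (fund_weight X i) (\<lambda>j. \<Sum>k\<in>nodes X. b k * simple_root X k j) =
          (\<Sum>k\<in>nodes X. b k * ip X (fund_weight X i) (simple_root X k))"
      unfolding ip_def sum_distrib_left
      by (subst sum.swap) (simp add: mult_ac)
    also have "\<dots> = (\<Sum>k\<in>nodes X. if k = i then b i * (ip X (simple_root X i) (simple_root X i) / 2) else 0)"
      using assms(1,2) by (intro sum.cong) (auto simp: ip_fund_weight_simple_root)
    finally show ?thesis using assms(2) by simp
  qed
  from this[of c] this[of d] show ?thesis
    using assms(3) ip_simple_root_self_pos[OF assms(1,2)] by simp
qed

section \<open>Words of simple reflections acting on weights and roots\<close>

lemma word_prod_Nil [simp]: "word_prod X [] = id"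
  by (simp add: word_prod_def)

lemma word_prod_Cons [simp]: "word_prod X (i # ws) = simple_refl X i \<circ> word_prod X ws"
  by (simp add: word_prod_def)

lemma word_prod_append: "word_prod X (us @ ws) = word_prod X us \<circ> word_prod X ws"
  by (induction us) auto

lemma simple_refl_diff:
  "simple_refl X i (\<lambda>j. u j - v j) = (\<lambda>j. simple_refl X i u j - simple_refl X i v j)"
  by (simp add: simple_refl_def coroot_pairing_diff algebra_simps)

lemma word_prod_diff:
  "word_prod X ws (\<lambda>j. u j - v j) = (\<lambda>j. word_prod X ws u j - word_prod X ws v j)"
  by (induction ws) (simp_all add: simple_refl_diff)

lemma bij_word_prod:
  assumes "admissible X" "set ws \<subseteq> nodes X"
  shows "bij (word_prod X ws)"
  using assms(2)
proof (induction ws)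
  case (Cons i ws)
  have "simple_refl X i (simple_refl X i v) = v" for v
    using assms(1) Cons.prems by (intro simple_refl_involution) (auto simp: admissible_def)
  then have "bij (simple_refl X i)"
    by (intro involuntory_imp_bij)
  with Cons show ?case unfolding word_prod_Cons by (intro bij_comp) auto
qed simp

lemma word_prod_fund_weight_fixed:
  assumes "admissible X" "set ws \<subseteq> nodes X" "i \<in> nodes X" "i \<notin> set ws"
  shows "word_prod X ws (fund_weight X i) = fund_weight X i"
  using assms(2,4)
  by (induction ws) (use assms(1,3) in \<open>auto simp: simple_refl_def coroot_pairing_fund_weight\<close>)

text \<open>The letters after \<open>i\<close> fix the weight, \<open>i\<close> subtracts its simple
  root, and the letters before \<open>i\<close> fix the weight again. The left side depends only on
  the group element, so the right side does too.\<close>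

lemma fund_weight_diff_word_prod:
  assumes "admissible X" "set (us @ i # ws) \<subseteq> nodes X" "distinct (us @ i # ws)"
  shows "(\<lambda>j. fund_weight X i j - word_prod X (us @ i # ws) (fund_weight X i) j) =
         word_prod X us (simple_root X i)"
proof -
  have "word_prod X (us @ i # ws) (fund_weight X i) =
        word_prod X us (simple_refl X i (fund_weight X i))"
    using assms by (simp add: word_prod_append word_prod_fund_weight_fixed)
  also have "simple_refl X i (fund_weight X i) = (\<lambda>j. fund_weight X i j - simple_root X i j)"
    using assms by (simp add: simple_refl_def coroot_pairing_fund_weight)
  also have "word_prod X us \<dots> =
      (\<lambda>j. fund_weight X i j - word_prod X us (simple_root X i) j)"
    using assms by (simp add: word_prod_diff word_prod_fund_weight_fixed)
  finally show ?thesis by simp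
qed

text \<open>
  A letter that is applied for the first time meets a vector with coefficient zero at its own
  simple root, so the off-diagonal signs of the Cartan matrix keep all coefficients nonnegative.
\<close>

lemma word_prod_simple_root_coeffs:
  assumes X: "admissible X" and i: "i \<in> nodes X"
    and "set us \<subseteq> nodes X" "distinct us" "i \<notin> set us"
  shows "\<exists>c. word_prod X us (simple_root X i) = (\<lambda>j. \<Sum>k\<in>nodes X. c k * simple_root X k j) \<and>
           (\<forall>k. 0 \<le> c k) \<and> c i = 1 \<and> (\<forall>k. k \<notin> insert i (set us) \<longrightarrow> c k = 0) \<and>
           (\<forall>k\<in>set us. adjacent X k i \<longrightarrow> 0 < c k)"
  using assms(3-)
proof (induction us)
  case Nil
  have "(\<Sum>k\<in>nodes X. (if k = i then 1 else 0) * simple_root X k j) = simple_root X i j" for j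
    using i by (simp add: if_distrib [of "\<lambda>x. x * _"] cong: if_cong)
  then show ?case by (intro exI[of _ "\<lambda>k. if k = i then 1 else 0"]) auto
next
  case (Cons l us)
  then obtain c where c: "word_prod X us (simple_root X i) = (\<lambda>j. \<Sum>k\<in>nodes X. c k * simple_root X k j)"
      "\<And>k. 0 \<le> c k" "c i = 1" "\<And>k. k \<notin> insert i (set us) \<Longrightarrow> c k = 0"
      "\<And>k. k \<in> set us \<Longrightarrow> adjacent X k i \<Longrightarrow> 0 < c k"
    by (auto simp: subset_iff)
  have l: "l \<in> nodes X" "l \<noteq> i" "c l = 0"
    using Cons.prems c(4) by auto
  \<comment> \<open>The reflection at \<open>l\<close> changes only the coefficient of
    \<open>\<alpha>\<^sub>l\<close>, which becomes \<open>p\<close> because it was zero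
    before.\<close>
  define p where "p = (\<Sum>k\<in>nodes X. c k * - coroot_pairing X l (simple_root X k))"
  have term_nonneg: "0 \<le> c k * - coroot_pairing X l (simple_root X k)" if "k \<in> nodes X" for k
    using coroot_pairing_simple_root_sign[OF X l(1) that] c(2)[of k] l(3)
    by (cases "k = l") (auto intro!: mult_nonneg_nonpos split: if_splits)
  then have p_nonneg: "0 \<le> p" unfolding p_def by (rule sum_nonneg)
  \<comment> \<open>The summand at \<open>i\<close> is strictly positive, as \<open>c i = 1\<close>
    and the pairing along an edge is negative.\<close>
  have p_pos: "0 < p" if "adjacent X l i"
    unfolding p_def
    using term_nonneg coroot_pairing_simple_root_sign[OF X l(1) i l(2)] that c(3)
    by (intro sum_pos2[OF _ i]) auto
  have "word_prod X (l # us) (simple_root X i) =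
      (\<lambda>j. (\<Sum>k\<in>nodes X. c k * simple_root X k j) + p * simple_root X l j)"
    by (simp add: c(1) simple_refl_def coroot_pairing_sum p_def sum_negf)
  also have "\<dots> = (\<lambda>j. \<Sum>k\<in>nodes X. (c(l := p)) k * simple_root X k j)"
  proof
    fix j
    show "(\<Sum>k\<in>nodes X. c k * simple_root X k j) + p * simple_root X l j =
        (\<Sum>k\<in>nodes X. (c(l := p)) k * simple_root X k j)"
      using l by (simp add: sum.remove[OF finite_nodes l(1)])
  qed
  finally show ?case
    using c l p_nonneg p_pos by (intro exI[of _ "c(l := p)"]) auto
qed

section \<open>Reduced words of Coxeter elements\<close>

text \<open>If \<open>i\<close> were missing from \<open>vs\<close>, the element would fix the
  weight at \<open>i\<close>; but the difference produced by \<open>ws\<close> has coefficient 1 at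
  \<open>\<alpha>\<^sub>i\<close>.\<close>

lemma nodes_subset_word:
  assumes X: "admissible X" and ws: "distinct ws" "set ws = nodes X"
    and vs: "set vs \<subseteq> nodes X" "word_prod X vs = word_prod X ws"
  shows "nodes X \<subseteq> set vs"
proof
  fix i assume i: "i \<in> nodes X"
  then obtain us us' where split: "ws = us @ i # us'"
    using split_list[of i ws] ws(2) by blast
  have sub: "set us \<subseteq> nodes X" "distinct us" "i \<notin> set us"
    using ws unfolding split by auto
  obtain c where c: "word_prod X us (simple_root X i) = (\<lambda>j. \<Sum>k\<in>nodes X. c k * simple_root X k j)"
      "c i = 1"
    using word_prod_simple_root_coeffs[OF X i sub] by blast
  show "i \<in> set vs"
  proof (rule ccontr)
    assume "i \<notin> set vs"
    then have "word_prod X ws (fund_weight X i) = fund_weight X i"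
      using word_prod_fund_weight_fixed[OF X vs(1) i] vs(2) by simp
    then have "word_prod X us (simple_root X i) = (\<lambda>j. 0)"
      using fund_weight_diff_word_prod[OF X, of us i us'] ws unfolding split
      by (metis cancel_comm_monoid_add_class.diff_cancel order_refl)
    then have "c i = 0"
      using simple_root_coeffs_unique[OF X i, of c "\<lambda>_. 0"] c(1) by simp
    with c(2) show False by simp
  qed
qed

text \<open>Every word for the element contains all nodes, so the minimal length is the rank, and a
  word of that length uses each node once.\<close>

lemma reduced_expression_coxeter_iff:
  assumes X: "admissible X" and ws: "distinct ws" "set ws = nodes X"
  shows "reduced_expression X (word_prod X ws) vs \<longleftrightarrow>
    distinct vs \<and> set vs = nodes X \<and> word_prod X vs = word_prod X ws"
    (is "?L \<longleftrightarrow> ?R")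
proof
  assume L: ?L
  then have vs: "set vs \<subseteq> nodes X" "word_prod X vs = word_prod X ws" "length vs \<le> length ws"
    using ws by (auto simp: reduced_expression_def)
  then have eq: "set vs = nodes X"
    using nodes_subset_word[OF X ws] by blast
  have "length ws = card (nodes X)"
    using ws distinct_card by metis
  with vs(3) eq have "card (set vs) = length vs"
    using card_length[of vs] by simp
  with eq vs show ?R by (simp add: card_distinct)
next
  assume R: ?R
  have "length vs \<le> length us" if "set us \<subseteq> nodes X" "word_prod X us = word_prod X ws" for us
  proof -
    have "length vs = card (nodes X)" using R distinct_card by metis
    also have "\<dots> \<le> card (set us)"
      using nodes_subset_word[OF X ws that] by (intro card_mono) auto
    also have "\<dots> \<le> length us" by (rule card_length)
    finally show ?thesis .
  qed
  with R show ?L by (auto simp: reduced_expression_def)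
qed

section \<open>Commutations and adapted words\<close>

lemma word_prod_commute:
  assumes "admissible X" "i \<in> nodes X" "set us \<subseteq> nodes X" "i \<notin> set us"
    "\<forall>j\<in>set us. \<not> adjacent X i j"
  shows "word_prod X us \<circ> simple_refl X i = simple_refl X i \<circ> word_prod X us"
  using assms(3-)
proof (induction us)
  case (Cons j us)
  then have "simple_refl X i \<circ> simple_refl X j = simple_refl X j \<circ> simple_refl X i"
    using assms(1,2) by (intro simple_refl_commute) auto
  moreover have "word_prod X us \<circ> simple_refl X i = simple_refl X i \<circ> word_prod X us"
    using Cons.prems by (intro Cons.IH) auto
  ultimately show ?case
    by (simp only: word_prod_Cons o_assoc[symmetric]) (simp only: o_assoc)
qed simp

text \<open>Only adjacent letters are compared, so exchanging neighbouring letters that commute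
  preserves the condition.\<close>

abbreviation height_ordered :: "quiver \<Rightarrow> nat list \<Rightarrow> bool" where
  "height_ordered Q \<equiv>
     sorted_wrt (\<lambda>i j. adjacent (diagram Q) i j \<longrightarrow> height Q j < height Q i)"

text \<open>The first letter of \<open>us\<close> can be moved to the front of \<open>vs\<close>: an
  adjacent letter before it in \<open>vs\<close> would be lower by the order of \<open>us\<close>
  and higher by that of \<open>vs\<close>.\<close>

lemma word_prod_height_ordered_unique:
  assumes X: "admissible (diagram Q)"
  shows "\<lbrakk>distinct us; distinct vs; set us = set vs; set us \<subseteq> nodes (diagram Q);
          height_ordered Q us; height_ordered Q vs\<rbrakk>
         \<Longrightarrow> word_prod (diagram Q) us = word_prod (diagram Q) vs"
proof (induction us arbitrary: vs)
  case (Cons x us)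
  let ?X = "diagram Q"
  from Cons.prems obtain a b where split: "vs = a @ x # b"
    by (metis list.set_intros(1) split_list)
  have nonadj: "\<not> adjacent ?X x y" if "y \<in> set a" for y
  proof
    assume adj: "adjacent ?X x y"
    have "y \<in> set us" using that Cons.prems split by auto
    then have "height Q y < height Q x" using Cons.prems(5) adj by auto
    moreover have "height Q x < height Q y"
      using Cons.prems(6) adjacent_sym[OF adj] that by (auto simp: split sorted_wrt_append)
    ultimately show False by simp
  qed
  have rest: "set us = set (a @ b)"
    using Cons.prems unfolding split by auto
  have "word_prod ?X vs = (word_prod ?X a \<circ> simple_refl ?X x) \<circ> word_prod ?X b"
    by (simp add: split word_prod_append fun_eq_iff)
  also have "word_prod ?X a \<circ> simple_refl ?X x = simple_refl ?X x \<circ> word_prod ?X a"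
    using Cons.prems nonadj split by (intro word_prod_commute[OF X]) auto
  also have "simple_refl ?X x \<circ> word_prod ?X a \<circ> word_prod ?X b =
             simple_refl ?X x \<circ> word_prod ?X (a @ b)"
    by (simp add: word_prod_append fun_eq_iff)
  also have "word_prod ?X (a @ b) = word_prod ?X us"
    using Cons.prems rest by (intro Cons.IH[symmetric]) (auto simp: split sorted_wrt_append)
  finally show ?case by simp
qed simp

lemma diagram_fold_reflect [simp]: "diagram (fold reflect_quiver us Q) = diagram Q"
  by (induction us arbitrary: Q) (simp_all add: reflect_quiver_def)

lemma height_fold_reflect:
  "distinct us \<Longrightarrow>
   height (fold reflect_quiver us Q) j = height Q j - (if j \<in> set us then 2 else 0)"
  by (induction us arbitrary: Q) (auto simp: reflect_quiver_def)

text \<open>A neighbour read earlier has dropped by 2; heights of neighbours differ by 1, so it is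
  already lower. The source condition therefore constrains only the neighbours still to
  come.\<close>

lemma adapted_iff_height_ordered:
  assumes Q: "dynkin_quiver Q" "admissible (diagram Q)"
    and us: "distinct us" "set us = nodes (diagram Q)"
  shows "adapted Q us \<longleftrightarrow> height_ordered Q us"
proof -
  let ?X = "diagram Q"
  have src: "source (fold reflect_quiver (take k us) Q) (us ! k) \<longleftrightarrow>
      (\<forall>l<length us. k < l \<longrightarrow> adjacent ?X (us ! k) (us ! l) \<longrightarrow> height Q (us ! l) < height Q (us ! k))"
    if k: "k < length us" for k
  proof -
    have in_take: "us ! l \<in> set (take k us) \<longleftrightarrow> l < k" if "l < length us" for l
      using that k us(1) by (auto simp: in_set_conv_nth nth_eq_iff_index_eq)
    have diff: "height Q (us ! l) - 2 < height Q (us ! k)"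
      if "l < length us" "adjacent ?X (us ! k) (us ! l)" for l
    proof -
      have "\<bar>height Q (us ! k) - height Q (us ! l)\<bar> = 1"
        using Q(1) that k us(2) unfolding dynkin_quiver_def by (metis nth_mem)
      then show ?thesis by linarith
    qed
    have "source (fold reflect_quiver (take k us) Q) (us ! k) \<longleftrightarrow>
      (\<forall>l<length us. adjacent ?X (us ! k) (us ! l) \<longrightarrow>
         height Q (us ! l) - (if l < k then 2 else 0) < height Q (us ! k))"
      using k us(1)
      by (auto simp: source_def height_fold_reflect in_take all_set_conv_all_nth
          simp flip: us(2))
    also have "\<dots> \<longleftrightarrow> (\<forall>l<length us. k < l \<longrightarrow> adjacent ?X (us ! k) (us ! l) \<longrightarrow>
         height Q (us ! l) < height Q (us ! k))"
      using diff adjacent_irrefl[OF Q(2)] by (auto simp: not_less_iff_gr_or_eq split: if_splits)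
    finally show ?thesis .
  qed
  then show ?thesis
    by (auto simp: adapted_def sorted_wrt_iff_nth_less)
qed

section \<open>Computing \<open>tau\<close> from a height-ordered word\<close>

lemma tau_eq_word_prod:
  assumes Q: "dynkin_quiver Q" "admissible (diagram Q)"
    and ws: "distinct ws" "set ws = nodes (diagram Q)" "height_ordered Q ws"
  shows "tau Q = word_prod (diagram Q) ws"
  unfolding tau_def
proof (rule the_equality, intro conjI allI impI)
  let ?X = "diagram Q"
  show "coxeter_element ?X (word_prod ?X ws)"
    using ws by (auto simp: coxeter_element_def)
  fix vs assume "reduced_expression ?X (word_prod ?X ws) vs"
  then have vs: "distinct vs" "set vs = nodes ?X" "word_prod ?X vs = word_prod ?X ws"
    using reduced_expression_coxeter_iff[OF Q(2) ws(1,2)] by auto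
  have "height Q (vs ! l) < height Q (vs ! k)"
    if kl: "k < l" "l < length vs" and adj: "adjacent ?X (vs ! k) (vs ! l)" for k l
  proof (rule ccontr)
    \<comment> \<open>If \<open>i\<close> is not higher than \<open>j\<close>, then \<open>j\<close>
      precedes \<open>i\<close> in \<open>ws\<close> but follows it in \<open>vs\<close>. The
      coefficient of \<open>\<alpha>\<^sub>j\<close> then comes out positive from \<open>ws\<close>
      and zero from \<open>vs\<close>.\<close>
    define i j where "i = vs ! k" and "j = vs ! l"
    assume "\<not> ?thesis"
    then have le: "height Q i \<le> height Q j" by (simp add: i_def j_def)
    have ij: "i \<in> nodes ?X" "j \<in> nodes ?X" "i \<noteq> j"
      using vs(1) kl nth_mem[of k vs] nth_mem[of l vs]
      by (simp_all add: i_def j_def nth_eq_iff_index_eq flip: vs(2))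
    obtain a b where a: "ws = a @ i # b" using split_list[of i ws] ij(1) ws(2) by blast
    have "j \<in> set a"
    proof (rule ccontr)
      assume "j \<notin> set a"
      then have "j \<in> set b" using ij ws(2) a by auto
      then have "height Q j < height Q i"
        using ws(3) adj by (auto simp: a sorted_wrt_append i_def j_def)
      with le show False by simp
    qed
    define a' b' where "a' = take k vs" and "b' = drop (Suc k) vs"
    have a': "vs = a' @ i # b'" using kl by (simp add: a'_def b'_def i_def id_take_nth_drop)
    have j_new: "j \<notin> insert i (set a')"
      using vs(1) kl ij(3) by (auto simp: a'_def j_def in_set_conv_nth nth_eq_iff_index_eq)
    have sub: "set a \<subseteq> nodes ?X" "distinct a" "i \<notin> set a" "set a' \<subseteq> nodes ?X" "distinct a'" "i \<notin> set a'"
      using ws vs by (auto simp: a a')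
    obtain c where c: "word_prod ?X a (simple_root ?X i) = (\<lambda>j. \<Sum>k\<in>nodes ?X. c k * simple_root ?X k j)"
        "0 < c j"
      using word_prod_simple_root_coeffs[OF Q(2) ij(1) sub(1-3)] \<open>j \<in> set a\<close> adj adjacent_sym
      unfolding i_def j_def by blast
    obtain c' where c': "word_prod ?X a' (simple_root ?X i) = (\<lambda>j. \<Sum>k\<in>nodes ?X. c' k * simple_root ?X k j)"
        "c' j = 0"
      using word_prod_simple_root_coeffs[OF Q(2) ij(1) sub(4-6)] j_new by blast
    \<comment> \<open>Both sides are \<open>(1 - w) \<varpi>\<^sub>i\<close> for the common product
      \<open>w\<close> of \<open>ws\<close> and \<open>vs\<close>.\<close>
    have "word_prod ?X a (simple_root ?X i) = word_prod ?X a' (simple_root ?X i)"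
      using fund_weight_diff_word_prod[OF Q(2), of a i b] fund_weight_diff_word_prod[OF Q(2), of a' i b']
        ws(1,2) vs unfolding a a' by (metis subset_refl)
    then have "c j = c' j"
      using simple_root_coeffs_unique[OF Q(2) ij(2)] c(1) c'(1) by metis
    with c(2) c'(2) show False by simp
  qed
  then show "adapted Q vs"
    using adapted_iff_height_ordered[OF Q vs(1,2)] by (auto simp: sorted_wrt_iff_nth_less)
next
  let ?X = "diagram Q"
  \<comment> \<open>Any other candidate has a word using each node once; this word is reduced, hence
    adapted, and so has the same product as \<open>ws\<close>.\<close>
  fix w assume w: "coxeter_element ?X w \<and> (\<forall>vs. reduced_expression ?X w vs \<longrightarrow> adapted Q vs)"
  then obtain us where us: "distinct us" "set us = nodes ?X" "word_prod ?X us = w"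
    by (auto simp: coxeter_element_def)
  then have "adapted Q us"
    using w reduced_expression_coxeter_iff[OF Q(2) us(1,2)] by auto
  then have "height_ordered Q us"
    using adapted_iff_height_ordered[OF Q us(1,2)] by simp
  then show "w = word_prod ?X ws"
    using word_prod_height_ordered_unique[OF Q(2), of us ws] us ws by simp
qed

text \<open>Neighbours never have equal height, so sorting by weakly decreasing height is
  enough.\<close>

lemma height_orderedI:
  assumes "dynkin_quiver Q" "set ws \<subseteq> nodes (diagram Q)"
    and "sorted_wrt (\<lambda>i j. height Q j \<le> height Q i) ws"
  shows "height_ordered Q ws"
  using assms(3)
proof (rule sorted_wrt_mono_rel[rotated])
  fix i j assume "i \<in> set ws" "j \<in> set ws" "height Q j \<le> height Q i"
  moreover from this have "adjacent (diagram Q) i j \<Longrightarrow> \<bar>height Q i - height Q j\<bar> = 1"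
    using assms(1,2) unfolding dynkin_quiver_def by blast
  ultimately show "adjacent (diagram Q) i j \<longrightarrow> height Q j < height Q i" by fastforce
qed

section \<open>Folding type D onto type B\<close>

text \<open>Each node of B_n is replaced by its preimage under the folding of D_{n+1}, that is, by
  an orbit of the diagram involution.\<close>

definition unfold_word :: "nat \<Rightarrow> nat list \<Rightarrow> nat list" where
  "unfold_word n ws = concat (map (\<lambda>i. if i = n then [n, n + 1] else [i]) ws)"

lemma unfold_word_simps [simp]:
  "unfold_word n [] = []"
  "unfold_word n (i # ws) = (if i = n then [n, n + 1] else [i]) @ unfold_word n ws"
  by (simp_all add: unfold_word_def)

lemma set_unfold_word: "set (unfold_word n ws) = set ws \<union> (if n \<in> set ws then {n + 1} else {})"
  by (induction ws) auto

lemma distinct_unfold_word: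
  "distinct ws \<Longrightarrow> n + 1 \<notin> set ws \<Longrightarrow> distinct (unfold_word n ws)"
  by (induction ws) (auto simp: set_unfold_word)

text \<open>Here the symmetry of the height function enters: the inserted \<open>n + 1\<close>
  stands right after \<open>n\<close> at the same height.\<close>

lemma sorted_wrt_unfold_word:
  assumes "h n = h (n + 1)" "sorted_wrt (\<lambda>i j. h j \<le> h i) ws"
  shows "sorted_wrt (\<lambda>i j. h j \<le> (h i :: int)) (unfold_word n ws)"
  using assms(2) by (induction ws) (use assms(1) in \<open>auto simp: set_unfold_word split: if_splits\<close>)

text \<open>For \<open>i < n\<close> the root involves only coordinates up to \<open>n\<close>,
  which \<open>psi\<close> keeps.\<close>

lemma psi_simple_refl:
  assumes "2 \<le> n" "1 \<le> i" "i < n"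
  shows "psi n (simple_refl (TypeD (n + 1)) i v) = simple_refl (TypeB n) i (psi n v)"
  using assms
  by (auto simp: simple_refl_def coroot_pairing_B coroot_pairing_D psi_def eps_apply fun_eq_iff)

text \<open>The product \<open>s\<^sub>n s\<^sub>n\<^sub>+\<^sub>1\<close> in type \<open>D\<close> negates the last two coordinates.\<close>

lemma psi_simple_refl_last:
  assumes "2 \<le> n"
  shows "psi n (simple_refl (TypeD (n + 1)) n (simple_refl (TypeD (n + 1)) (n + 1) v)) =
         simple_refl (TypeB n) n (psi n v)"
  using assms
  by (auto simp: simple_refl_def coroot_pairing_B coroot_pairing_D psi_def eps_apply fun_eq_iff)

lemma psi_word_prod_unfold:
  assumes "2 \<le> n" "set ws \<subseteq> {1..n}"
  shows "psi n (word_prod (TypeD (n + 1)) (unfold_word n ws) v) = word_prod (TypeB n) ws (psi n v)"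
  using assms(2)
proof (induction ws)
  case (Cons i ws)
  then show ?case
    using psi_simple_refl[OF assms(1), of i] psi_simple_refl_last[OF assms(1)]
    by (cases "i = n") auto
qed simp

text \<open>Bijectivity of \<open>f\<close> and \<open>g\<close> carries the relation over to their
  inverses, which settles negative exponents.\<close>

lemma int_power_intertwine:
  assumes "bij f" "bij g" and fg: "\<And>v. p (f v) = g (p v)"
  shows "p (int_power f k v) = int_power g k (p v)"
proof -
  have pow: "p ((f' ^^ m) v) = (g' ^^ m) (p v)" if "\<And>v. p (f' v) = g' (p v)" for f' g' m
    by (induction m) (auto simp: that)
  have "p (inv f v) = inv g (p v)" for v
    by (metis assms bij_inv_eq_iff)
  then show ?thesis
    using pow[of f g, OF fg] pow[of "inv f" "inv g"] by (simp add: int_power_def)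
qed

text \<open>Dropping the last coordinate identifies the two half-spin weights with the spin weight
  of B_n; \<open>min i n\<close> is the folded index.\<close>

lemma psi_fund_weight:
  assumes "2 \<le> n" "1 \<le> i" "i \<le> n + 1"
  shows "psi n (fund_weight (TypeD (n + 1)) i) = fund_weight (TypeB n) (min i n)"
  using assms by (auto simp: fund_weight_D fund_weight_B psi_def fun_eq_iff min_def)

theorem theorem5p10:
  fixes n :: nat and Q Qbar :: quiver and k :: int
  assumes "n \<ge> 2"
    and "dynkin_quiver Q" and "diagram Q = TypeD (n + 1)"
    and "height Q n = height Q (n + 1)"
    and "dynkin_quiver Qbar" and "diagram Qbar = TypeB n"
    and "\<forall>i\<in>{1..n}. height Qbar i = height Q i"
  shows "(\<forall>i. 1 \<le> i \<and> i < n \<longrightarrow>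
            psi n (int_power (tau Q) k (gamma Q i)) = int_power (tau Qbar) k (gamma Qbar i)) \<and>
         (\<forall>i\<in>{n, n + 1}.
            psi n (int_power (tau Q) k (gamma Q i)) = int_power (tau Qbar) k (gamma Qbar n))"
proof -
  have adm: "admissible (diagram Q)" "admissible (diagram Qbar)"
    using assms by (auto simp: admissible_def)
  \<comment> \<open>\<open>sort_key\<close> is ascending, hence the sign. The node
    \<open>n + 1\<close> is left out because unfolding brings it back.\<close>
  define ws where "ws = sort_key (\<lambda>i. - height Q i) [1..<n + 1]"
  have ws: "distinct ws" "set ws = {1..n}"
    by (auto simp: ws_def)
  have sorted: "sorted_wrt (\<lambda>i j. height Q j \<le> height Q i) ws"
    using sorted_sort_key[of "\<lambda>i. - height Q i" "[1..<n + 1]"]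
    by (simp add: ws_def sorted_map)
  \<comment> \<open>The heights agree on the nodes of B_n, so one word serves both quivers.\<close>
  then have "sorted_wrt (\<lambda>i j. height Qbar j \<le> height Qbar i) ws"
    using assms(7) ws(2) by (auto elim!: sorted_wrt_mono_rel[rotated])
  then have tau_Qbar: "tau Qbar = word_prod (TypeB n) ws"
    using tau_eq_word_prod[OF assms(5) adm(2), of ws] height_orderedI[OF assms(5), of ws] ws assms(6)
    by (simp add: nodes_def)
  let ?us = "unfold_word n ws"
  have us: "distinct ?us" "set ?us = nodes (diagram Q)"
    using ws distinct_unfold_word[of ws n] assms(1,3) by (auto simp: set_unfold_word nodes_def)
  then have tau_Q: "tau Q = word_prod (TypeD (n + 1)) ?us"
    using tau_eq_word_prod[OF assms(2) adm(1) us] height_orderedI[OF assms(2), of ?us]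
      sorted_wrt_unfold_word[of "height Q", OF assms(4) sorted] assms(3) by simp
  have psi_tau: "psi n (tau Q v) = tau Qbar (psi n v)" for v
    using psi_word_prod_unfold[OF assms(1)] ws by (simp add: tau_Q tau_Qbar)
  have bij: "bij (tau Q)" "bij (tau Qbar)"
    using bij_word_prod adm us ws assms(3,6) by (auto simp: tau_Q tau_Qbar nodes_def)
  have psi_diff: "psi n (\<lambda>j. u j - v j) = (\<lambda>j. psi n u j - psi n v j)" for u v
    using psi_linear[of n 1 u "-1" v] by simp
  have "psi n (gamma Q i) = gamma Qbar (min i n)" if "1 \<le> i" "i \<le> n + 1" for i
    using that psi_fund_weight[OF assms(1) that] assms(3,6)
    by (simp add: gamma_def psi_diff psi_tau)
  then have "psi n (int_power (tau Q) k (gamma Q i)) = int_power (tau Qbar) k (gamma Qbar (min i n))"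
    if "1 \<le> i" "i \<le> n + 1" for i
    using int_power_intertwine[of "tau Q" "tau Qbar" "psi n", OF bij psi_tau] that by simp
  then show ?thesis
    using assms(1) by (auto simp: min_def)
qed

end
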